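(* For $\boldsymbol\rho=(\rho_{31},\rho_{12},\rho_{23})\in\mathbb R^3$ and $r^2=\rho_{31}^2+\rho_{12}^2+\rho_{23}^2$, consider $$V_0(\boldsymbol\rho)=-\frac{m^2}{2}r^2+\frac{\lambda_\Phi}{4}r^4+\kappa_\Phi\,\rho_{31}\rho_{12}\rho_{23}.$$ At a stationary point of $V_0$ at which every component of $\boldsymbol\rho$ is nonzero, if $\kappa_\Phi\ne0$, then $a=-m^2+\lambda_\Phi r^2$ is nonzero and $$|\rho_{31}|=|\rho_{12}|=|\rho_{23}|.$$ If $\kappa_\Phi=0$, the radial minimum leaves the direction of $\boldsymbol\rho$ flat. Thus this specific potential gives equal edge magnitudes or no directional selection, and it cannot account for the observed hierarchy of lepton rotations.
   Context: Here $m^2,\lambda_\Phi,\kappa_\Phi$ are real parameters, and $\rho_{31},\rho_{12},\rho_{23}$ are three real amplitudes ("edge amplitudes") whose values are to fix the lepton rotations. A stationary point is a zero of the gradient of $V_0$ on $\mathbb R^3$; a point with all three components nonzero is called full-rank. The radial minimum is the minimum of $V_0$ as a function of $r$ when $\kappa_\Phi=0$; "flat" means that $V_0$ does not select the direction of $\boldsymbol\rho$. The result concerns only this radial-quartic truncation, not general potentials invariant under cyclic permutation of the three amplitudes. *)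

theory Defs
  imports "HOL-Analysis.Analysis"
begin

text \<open>
  Edge amplitudes are vectors \<open>\<rho> :: real^3\<close> with
  \<open>\<rho>$1 = \<rho>\<^sub>3\<^sub>1\<close>, \<open>\<rho>$2 = \<rho>\<^sub>1\<^sub>2\<close>, \<open>\<rho>$3 = \<rho>\<^sub>2\<^sub>3\<close>; the radius \<open>r\<close> is the Euclidean norm of \<open>\<rho>\<close>.
  The real parameter \<open>msq\<close> stands for \<open>m\<^sup>2\<close>; its sign is not restricted.
\<close>

definition V0 :: "real \<Rightarrow> real \<Rightarrow> real \<Rightarrow> real^3 \<Rightarrow> real" where
  "V0 msq lam kap \<rho> =
     - (msq / 2) * norm \<rho> ^ 2 + (lam / 4) * norm \<rho> ^ 4 + kap * (\<rho>$1 * \<rho>$2 * \<rho>$3)"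

definition radial_potential :: "real \<Rightarrow> real \<Rightarrow> real \<Rightarrow> real" where
  "radial_potential msq lam r = - (msq / 2) * r ^ 2 + (lam / 4) * r ^ 4"

definition radial_minimum :: "real \<Rightarrow> real \<Rightarrow> real \<Rightarrow> bool" where
  "radial_minimum msq lam r \<longleftrightarrow> is_arg_min (radial_potential msq lam) (\<lambda>s. 0 \<le> s) r"

definition stationary_point :: "(real^3 \<Rightarrow> real) \<Rightarrow> real^3 \<Rightarrow> bool" where
  "stationary_point V \<rho> \<longleftrightarrow> (GDERIV V \<rho> :> 0)"

definition full_rank :: "real^3 \<Rightarrow> bool" where
  "full_rank \<rho> \<longleftrightarrow> (\<forall>i. \<rho>$i \<noteq> 0)"

definition equal_magnitudes :: "real^3 \<Rightarrow> bool" where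
  "equal_magnitudes \<rho> \<longleftrightarrow> \<bar>\<rho>$1\<bar> = \<bar>\<rho>$2\<bar> \<and> \<bar>\<rho>$2\<bar> = \<bar>\<rho>$3\<bar>"

definition flat_direction :: "(real^3 \<Rightarrow> real) \<Rightarrow> real \<Rightarrow> bool" where
  "flat_direction V r \<longleftrightarrow> (\<forall>\<rho> \<rho>'. norm \<rho> = r \<longrightarrow> norm \<rho>' = r \<longrightarrow> V \<rho> = V \<rho>')"

text \<open>
  A potential accounts for a pattern \<open>h\<close> of relative edge amplitudes if it has a
  stationary point in the direction of \<open>h\<close> and does distinguish between directions at that radius.
  The selection requirement is the weakest possible one: the potential is not constant
  on the sphere through the stationary point.
\<close>

definition accounts_for :: "(real^3 \<Rightarrow> real) \<Rightarrow> real^3 \<Rightarrow> bool" where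
  "accounts_for V h \<longleftrightarrow>
     (\<exists>c>0. stationary_point V (c *\<^sub>R h) \<and> \<not> flat_direction V (norm (c *\<^sub>R h)))"

end

theory Submission
  imports Defs
begin

text \<open>
  Taking the inner product of the stationarity equation with each coordinate axis and
  multiplying by the corresponding amplitude gives
  \<open>a \<rho>\<^sub>i\<^sup>2 = - \<kappa> \<rho>\<^sub>3\<^sub>1 \<rho>\<^sub>1\<^sub>2 \<rho>\<^sub>2\<^sub>3\<close> with a right-hand side independent of \<open>i\<close>. It is nonzero
  when \<open>\<kappa> \<noteq> 0\<close> and no amplitude vanishes, so \<open>a \<noteq> 0\<close> and all \<open>\<rho>\<^sub>i\<^sup>2\<close> coincide.
\<close>

lemma GDERIV_V0:
  "GDERIV (V0 msq lam kap) \<rho> :>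
     (- msq + lam * norm \<rho> ^ 2) *\<^sub>R \<rho> + kap *\<^sub>R vector [\<rho>$2 * \<rho>$3, \<rho>$1 * \<rho>$3, \<rho>$1 * \<rho>$2]"
proof -
  \<comment> \<open>With \<open>x \<bullet> x\<close> in place of the norm the potential is visibly
    polynomial, so the origin, where the norm itself is not differentiable, needs no separate
    case.\<close>
  have V0_inner: "V0 msq lam kap =
      (\<lambda>x. - (msq / 2) * (x \<bullet> x) + (lam / 4) * (x \<bullet> x)^2 + kap * (x$1 * x$2 * x$3))"
    by (simp add: V0_def fun_eq_iff flip: power2_norm_eq_inner)
  have nth: "((\<lambda>x. x$i) has_derivative (\<lambda>h. h$i)) (at \<rho>)" for i :: 3
    by (rule bounded_linear_imp_has_derivative) (rule bounded_linear_vec_nth)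
  \<comment> \<open>This is the shape that the product rule produces; expanding in coordinates then
    identifies it with the inner product against the gradient.\<close>
  have "(V0 msq lam kap has_derivative
      (\<lambda>h. - (msq / 2) * (\<rho> \<bullet> h + h \<bullet> \<rho>) + (lam / 4) * (2 * (\<rho> \<bullet> \<rho>) * (\<rho> \<bullet> h + h \<bullet> \<rho>))
         + kap * (\<rho>$1 * \<rho>$2 * h$3 + (\<rho>$1 * h$2 + h$1 * \<rho>$2) * \<rho>$3))) (at \<rho>)"
    unfolding V0_inner
    by (auto intro!: derivative_eq_intros nth simp: inner_commute field_simps)
  then show ?thesis
    unfolding gderiv_def power2_norm_eq_inner
    by (rule has_derivative_eq_rhs)
      (simp add: fun_eq_iff inner_vec_def sum_3 vector_3 algebra_simps)
qed

lemma stationary_point_V0_components: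
  assumes "stationary_point (V0 msq lam kap) \<rho>"
  shows "(- msq + lam * norm \<rho> ^ 2) * \<rho>$1 + kap * (\<rho>$2 * \<rho>$3) = 0"
    and "(- msq + lam * norm \<rho> ^ 2) * \<rho>$2 + kap * (\<rho>$1 * \<rho>$3) = 0"
    and "(- msq + lam * norm \<rho> ^ 2) * \<rho>$3 + kap * (\<rho>$1 * \<rho>$2) = 0"
proof -
  let ?g = "(- msq + lam * norm \<rho> ^ 2) *\<^sub>R \<rho>
    + kap *\<^sub>R vector [\<rho>$2 * \<rho>$3, \<rho>$1 * \<rho>$3, \<rho>$1 * \<rho>$2] :: real^3"
  \<comment> \<open>\<open>GDERIV\<close> is a relation, so the computed gradient and 0 are compared
    through uniqueness of the Frechet derivative. Evaluating both functionals at \<open>?g\<close>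
    itself then gives \<open>?g \<bullet> ?g = 0\<close>.\<close>
  have "(\<lambda>h. h \<bullet> ?g) = (\<lambda>h. h \<bullet> 0)"
    using assms GDERIV_V0[of msq lam kap \<rho>]
    unfolding stationary_point_def gderiv_def by (metis has_derivative_unique)
  then have "?g = 0"
    by (metis inner_eq_zero_iff inner_zero_right)
  then have "?g$i = 0" for i
    by simp
  from this[of 1] this[of 2] this[of 3] show
    "(- msq + lam * norm \<rho> ^ 2) * \<rho>$1 + kap * (\<rho>$2 * \<rho>$3) = 0"
    "(- msq + lam * norm \<rho> ^ 2) * \<rho>$2 + kap * (\<rho>$1 * \<rho>$3) = 0"
    "(- msq + lam * norm \<rho> ^ 2) * \<rho>$3 + kap * (\<rho>$1 * \<rho>$2) = 0"
    by (simp_all add: vector_3)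
qed

lemma stationary_full_rank_V0:
  assumes "kap \<noteq> 0" "stationary_point (V0 msq lam kap) \<rho>" "full_rank \<rho>"
  shows "- msq + lam * norm \<rho> ^ 2 \<noteq> 0" and "equal_magnitudes \<rho>"
proof -
  define a where "a = - msq + lam * norm \<rho> ^ 2"
  define p where "p = - (kap * (\<rho>$1 * \<rho>$2 * \<rho>$3))"
  have nz: "\<rho>$1 \<noteq> 0" "\<rho>$2 \<noteq> 0" "\<rho>$3 \<noteq> 0"
    using assms(3) by (auto simp: full_rank_def)
  note eqs = stationary_point_V0_components[OF assms(2), folded a_def]
  have sq: "a * (\<rho>$1)^2 = p" "a * (\<rho>$2)^2 = p" "a * (\<rho>$3)^2 = p"
    using eqs unfolding p_def by algebra+
  have "p \<noteq> 0"
    using assms(1) nz by (simp add: p_def)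
  with sq have "a \<noteq> 0"
    by auto
  then show "- msq + lam * norm \<rho> ^ 2 \<noteq> 0"
    by (simp add: a_def)
  have "(\<rho>$1)^2 = (\<rho>$2)^2" "(\<rho>$2)^2 = (\<rho>$3)^2"
    using sq \<open>a \<noteq> 0\<close> by (metis mult_left_cancel)+
  then show "equal_magnitudes \<rho>"
    by (auto simp: equal_magnitudes_def power2_eq_iff)
qed

lemma V0_eq_radial_potential: "V0 msq lam 0 \<rho> = radial_potential msq lam (norm \<rho>)"
  by (simp add: V0_def radial_potential_def)

lemma flat_direction_V0: "flat_direction (V0 msq lam 0) r"
  by (simp add: flat_direction_def V0_eq_radial_potential)

text \<open>Every norm is a nonnegative radius and thus an admissible competitor in the radial
  problem, so a radial minimum is a global one on the whole space.\<close>

lemma radial_minimum_is_arg_min_V0: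
  assumes "radial_minimum msq lam (norm \<rho>)"
  shows "is_arg_min (V0 msq lam 0) (\<lambda>_. True) \<rho>"
  using assms by (simp add: radial_minimum_def is_arg_min_def V0_eq_radial_potential)

text \<open>The two alternatives come from \<open>kap \<noteq> 0\<close> and \<open>kap = 0\<close>.
  Flatness is taken at the radius of the stationary point, as in
  \<open>accounts_for\<close>.\<close>

lemma equal_magnitudes_or_flat_V0:
  assumes "stationary_point (V0 msq lam kap) \<rho>" "full_rank \<rho>"
  shows "equal_magnitudes \<rho> \<or> flat_direction (V0 msq lam kap) (norm \<rho>)"
  using assms stationary_full_rank_V0(2) flat_direction_V0 by (cases "kap = 0") auto

text \<open>The observed hierarchy enters only as a pattern \<open>h\<close> with nonzero, not all
  equal magnitudes. Both properties survive scaling by \<open>c > 0\<close>, so the dichotomy at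
  \<open>c *\<^sub>R h\<close> transfers back to \<open>h\<close>.\<close>

lemma not_accounts_for_V0:
  assumes "full_rank h" "\<not> equal_magnitudes h"
  shows "\<not> accounts_for (V0 msq lam kap) h"
proof
  assume "accounts_for (V0 msq lam kap) h"
  then obtain c where c: "c > 0" "stationary_point (V0 msq lam kap) (c *\<^sub>R h)"
      "\<not> flat_direction (V0 msq lam kap) (norm (c *\<^sub>R h))"
    unfolding accounts_for_def by blast
  have "full_rank (c *\<^sub>R h)"
    using c(1) assms(1) by (simp add: full_rank_def)
  with c have "equal_magnitudes (c *\<^sub>R h)"
    using equal_magnitudes_or_flat_V0 by blast
  with c(1) assms(2) show False
    by (simp add: equal_magnitudes_def abs_mult)
qed

theorem mainTheorem11:
  fixes msq lam kap :: real
  shows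
    "(kap \<noteq> 0 \<longrightarrow>
        (\<forall>\<rho>. stationary_point (V0 msq lam kap) \<rho> \<and> full_rank \<rho> \<longrightarrow>
           - msq + lam * norm \<rho> ^ 2 \<noteq> 0 \<and> \<bar>\<rho>$1\<bar> = \<bar>\<rho>$2\<bar> \<and> \<bar>\<rho>$2\<bar> = \<bar>\<rho>$3\<bar>))
   \<and> (kap = 0 \<longrightarrow>
        (\<forall>\<rho>. V0 msq lam kap \<rho> = radial_potential msq lam (norm \<rho>)) \<and>
        (\<forall>r. radial_minimum msq lam r \<longrightarrow>
           (\<forall>\<rho>. norm \<rho> = r \<longrightarrow> is_arg_min (V0 msq lam kap) (\<lambda>_. True) \<rho>) \<and>
           flat_direction (V0 msq lam kap) r))
   \<and> (\<forall>\<rho>. stationary_point (V0 msq lam kap) \<rho> \<and> full_rank \<rho> \<longrightarrow>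
        equal_magnitudes \<rho> \<or> flat_direction (V0 msq lam kap) (norm \<rho>))
   \<and> (\<forall>h. full_rank h \<and> \<not> equal_magnitudes h \<longrightarrow> \<not> accounts_for (V0 msq lam kap) h)"
  using stationary_full_rank_V0[unfolded equal_magnitudes_def]
  by (auto simp: V0_eq_radial_potential flat_direction_V0 radial_minimum_is_arg_min_V0
      equal_magnitudes_or_flat_V0 not_accounts_for_V0)

end
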